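(* There is a category $\mathbf{Graph}_{LP}$ whose objects are connected graphs and whose morphisms are the strongly line-proper morphisms. There is a functor $L:\mathbf{Graph}_{LP}\to\mathbf{Graph}_{SP}$ that maps each graph $G$ to its line graph $L(G)$ and each strongly line-proper morphism $\phi:G_1\to G_2$ to a strongly proper morphism $L(\phi):L(G_1)\to L(G_2)$ such that $L(\phi)(\{u,v\})=\{\phi(u),\phi(v)\}$ for every edge $\{u,v\}\in E(G_1)$.
   Context: Graphs are simple and undirected, possibly infinite. A graph homomorphism is a map of vertex sets sending adjacent vertices to adjacent vertices. A 1-complex morphism is a map of vertex sets sending adjacent vertices either to adjacent vertices or to a single vertex. Composition is composition of maps. Line graph. $L(G)$ is the graph with vertex set $E(G)$ in which two distinct edges of $G$ are adjacent exactly when they share a vertex. Strongly line-proper. A graph homomorphism $\phi:G_1\to G_2$ between connected graphs is strongly line-proper if for every edge $e\in E(G_2)$ the set $L(\phi)^{-1}(e)$ of edges $\{u,v\}\in E(G_1)$ with $\{\phi(u),\phi(v)\}=e$ is finite. Strongly proper. A ray is a one-way infinite path without repeated vertices. A set $U\subset V(G)$ is dispersed if for every ray $r$ of $G$ there is a finite $F\subset V(G)$ such that the connected component of $G\setminus F$ containing a tail of $r$ is disjoint from $U$. A 1-complex morphism $\psi:H_1\to H_2$ is strongly proper if $\psi^{-1}(v)$ is dispersed for every $v\in V(H_2)$. $\mathbf{Graph}_{SP}$ is the category of connected graphs with strongly proper morphisms (strongly proper morphisms are closed under composition). *)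

theory Defs
  imports Main "HOL-Library.FuncSet"
begin

section \<open>Categories and functors\<close>

text \<open>
  A category is given by a family of hom-sets indexed by pairs of objects. The hom-sets need not
  be pairwise disjoint, so identities, composition and the action of a functor on morphisms carry
  the objects involved: \<open>Comp C X Y Z g f\<close> is the composite of \<open>f : X \<rightarrow> Y\<close> and
  \<open>g : Y \<rightarrow> Z\<close>.
\<close>

record ('o, 'm) category_data =
  Obj :: "'o set"
  Hom :: "'o \<Rightarrow> 'o \<Rightarrow> 'm set"
  Id :: "'o \<Rightarrow> 'm"
  Comp :: "'o \<Rightarrow> 'o \<Rightarrow> 'o \<Rightarrow> 'm \<Rightarrow> 'm \<Rightarrow> 'm"

locale category =
  fixes C :: "('o, 'm) category_data"
  assumes Id_in_Hom: "X \<in> Obj C \<Longrightarrow> Id C X \<in> Hom C X X"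
    and Comp_in_Hom:
      "\<lbrakk>X \<in> Obj C; Y \<in> Obj C; Z \<in> Obj C; f \<in> Hom C X Y; g \<in> Hom C Y Z\<rbrakk>
        \<Longrightarrow> Comp C X Y Z g f \<in> Hom C X Z"
    and Comp_Id_right:
      "\<lbrakk>X \<in> Obj C; Y \<in> Obj C; f \<in> Hom C X Y\<rbrakk> \<Longrightarrow> Comp C X X Y f (Id C X) = f"
    and Comp_Id_left:
      "\<lbrakk>X \<in> Obj C; Y \<in> Obj C; f \<in> Hom C X Y\<rbrakk> \<Longrightarrow> Comp C X Y Y (Id C Y) f = f"
    and Comp_assoc:
      "\<lbrakk>W \<in> Obj C; X \<in> Obj C; Y \<in> Obj C; Z \<in> Obj C;
        f \<in> Hom C W X; g \<in> Hom C X Y; h \<in> Hom C Y Z\<rbrakk>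
        \<Longrightarrow> Comp C W Y Z h (Comp C W X Y g f) = Comp C W X Z (Comp C X Y Z h g) f"

record ('o, 'm, 'p, 'n) functor_data =
  on_obj :: "'o \<Rightarrow> 'p"
  on_hom :: "'o \<Rightarrow> 'o \<Rightarrow> 'm \<Rightarrow> 'n"

locale category_functor = source: category C + target: category D
  for C :: "('o, 'm) category_data" and D :: "('p, 'n) category_data" +
  fixes F :: "('o, 'm, 'p, 'n) functor_data"
  assumes on_obj_in_Obj: "X \<in> Obj C \<Longrightarrow> on_obj F X \<in> Obj D"
    and on_hom_in_Hom:
      "\<lbrakk>X \<in> Obj C; Y \<in> Obj C; f \<in> Hom C X Y\<rbrakk>
        \<Longrightarrow> on_hom F X Y f \<in> Hom D (on_obj F X) (on_obj F Y)"
    and on_hom_Id: "X \<in> Obj C \<Longrightarrow> on_hom F X X (Id C X) = Id D (on_obj F X)"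
    and on_hom_Comp:
      "\<lbrakk>X \<in> Obj C; Y \<in> Obj C; Z \<in> Obj C; f \<in> Hom C X Y; g \<in> Hom C Y Z\<rbrakk>
        \<Longrightarrow> on_hom F X Z (Comp C X Y Z g f) =
            Comp D (on_obj F X) (on_obj F Y) (on_obj F Z) (on_hom F Y Z g) (on_hom F X Y f)"


section \<open>Graphs\<close>

record 'a graph =
  verts :: "'a set"
  edges :: "'a set set"

definition simple_graph :: "'a graph \<Rightarrow> bool" where
  "simple_graph G \<longleftrightarrow>
    (\<forall>e \<in> edges G. \<exists>u v. u \<in> verts G \<and> v \<in> verts G \<and> u \<noteq> v \<and> e = {u, v})"

definition adj :: "'a graph \<Rightarrow> 'a \<Rightarrow> 'a \<Rightarrow> bool" where
  "adj G u v \<longleftrightarrow> {u, v} \<in> edges G"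

definition reachable :: "'a graph \<Rightarrow> 'a \<Rightarrow> 'a \<Rightarrow> bool" where
  "reachable G u v \<longleftrightarrow> u \<in> verts G \<and> v \<in> verts G \<and> (adj G)\<^sup>*\<^sup>* u v"

text \<open>
  The empty graph counts as connected. This is needed because the line graph of a graph with a
  single vertex is empty.
\<close>

definition connected_graph :: "'a graph \<Rightarrow> bool" where
  "connected_graph G \<longleftrightarrow>
    simple_graph G \<and> (\<forall>u \<in> verts G. \<forall>v \<in> verts G. reachable G u v)"

definition components :: "'a graph \<Rightarrow> 'a set set" where
  "components G = {{w. reachable G v w} | v. v \<in> verts G}"

definition delete_verts :: "'a graph \<Rightarrow> 'a set \<Rightarrow> 'a graph" where
  "delete_verts G F = \<lparr>verts = verts G - F, edges = {e \<in> edges G. e \<inter> F = {}}\<rparr>"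

definition line_graph :: "'a graph \<Rightarrow> 'a set graph" where
  "line_graph G =
    \<lparr>verts = edges G,
     edges = {{e, f} | e f. e \<in> edges G \<and> f \<in> edges G \<and> e \<noteq> f \<and> e \<inter> f \<noteq> {}}\<rparr>"


section \<open>Morphisms of graphs\<close>

text \<open>
  Maps between vertex sets are extensional functions, so that equality of morphisms is equality
  of maps on the vertex set of the source.
\<close>

definition graph_hom :: "'a graph \<Rightarrow> 'b graph \<Rightarrow> ('a \<Rightarrow> 'b) \<Rightarrow> bool" where
  "graph_hom G1 G2 \<phi> \<longleftrightarrow>
    \<phi> \<in> verts G1 \<rightarrow>\<^sub>E verts G2 \<and> (\<forall>u v. adj G1 u v \<longrightarrow> adj G2 (\<phi> u) (\<phi> v))"

definition complex_morphism :: "'a graph \<Rightarrow> 'b graph \<Rightarrow> ('a \<Rightarrow> 'b) \<Rightarrow> bool" where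
  "complex_morphism H1 H2 \<psi> \<longleftrightarrow>
    \<psi> \<in> verts H1 \<rightarrow>\<^sub>E verts H2 \<and>
    (\<forall>u v. adj H1 u v \<longrightarrow> adj H2 (\<psi> u) (\<psi> v) \<or> \<psi> u = \<psi> v)"

definition strongly_line_proper :: "'a graph \<Rightarrow> 'b graph \<Rightarrow> ('a \<Rightarrow> 'b) \<Rightarrow> bool" where
  "strongly_line_proper G1 G2 \<phi> \<longleftrightarrow>
    graph_hom G1 G2 \<phi> \<and>
    (\<forall>e \<in> edges G2. finite {{u, v} | u v. {u, v} \<in> edges G1 \<and> {\<phi> u, \<phi> v} = e})"

definition ray :: "'a graph \<Rightarrow> (nat \<Rightarrow> 'a) \<Rightarrow> bool" where
  "ray G r \<longleftrightarrow> inj r \<and> (\<forall>n. adj G (r n) (r (Suc n)))"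

text \<open>
  Any two tails of a ray intersect, so at most one component of \<open>delete_verts G F\<close> contains a
  tail of a given ray.
\<close>

definition dispersed :: "'a graph \<Rightarrow> 'a set \<Rightarrow> bool" where
  "dispersed G U \<longleftrightarrow>
    U \<subseteq> verts G \<and>
    (\<forall>r. ray G r \<longrightarrow>
      (\<exists>F K. finite F \<and> F \<subseteq> verts G \<and> K \<in> components (delete_verts G F) \<and>
        (\<exists>n. \<forall>m \<ge> n. r m \<in> K) \<and> K \<inter> U = {}))"

definition strongly_proper :: "'a graph \<Rightarrow> 'b graph \<Rightarrow> ('a \<Rightarrow> 'b) \<Rightarrow> bool" where
  "strongly_proper H1 H2 \<psi> \<longleftrightarrow>
    complex_morphism H1 H2 \<psi> \<and>
    (\<forall>v \<in> verts H2. dispersed H1 {u \<in> verts H1. \<psi> u = v})"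


section \<open>The two categories of connected graphs\<close>

definition Graph_LP :: "('a graph, 'a \<Rightarrow> 'a) category_data" where
  "Graph_LP =
    \<lparr>Obj = {G. connected_graph G},
     Hom = (\<lambda>G1 G2. {\<phi>. strongly_line_proper G1 G2 \<phi>}),
     Id = (\<lambda>G. restrict id (verts G)),
     Comp = (\<lambda>G1 G2 G3 g f. compose (verts G1) g f)\<rparr>"

definition Graph_SP :: "('a graph, 'a \<Rightarrow> 'a) category_data" where
  "Graph_SP =
    \<lparr>Obj = {G. connected_graph G},
     Hom = (\<lambda>H1 H2. {\<psi>. strongly_proper H1 H2 \<psi>}),
     Id = (\<lambda>H. restrict id (verts H)),
     Comp = (\<lambda>H1 H2 H3 g f. compose (verts H1) g f)\<rparr>"

end

theory Submission
  imports Defs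
begin

text \<open>
  The substance is that strongly proper morphisms compose. Strong properness of a morphism makes
  it pull back every dispersed set, not just single vertices, to a dispersed set: the image of a
  ray visits each vertex finitely often, so it contains a ray, obtained by always jumping to the
  last visit of the next vertex. A finite set separating this ray from the given dispersed set
  has a dispersed preimage, and whatever separates the original ray from that preimage also
  separates it from the preimage of the given set. For line graphs, strong line-properness makes
  the fibres finite, and finite sets are dispersed.
\<close>

section \<open>Reachability and dispersed sets\<close>

lemma adj_sym: "adj G u v \<Longrightarrow> adj G v u"
  by (simp add: adj_def insert_commute)

lemma adjE:
  assumes "simple_graph G" "adj G u v"
  obtains "u \<in> verts G" "v \<in> verts G" "u \<noteq> v"
proof -
  obtain a b where "a \<in> verts G" "b \<in> verts G" "a \<noteq> b" "{u, v} = {a, b}"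
    using assms unfolding simple_graph_def adj_def by blast
  then show thesis
    using that by (auto simp: doubleton_eq_iff)
qed

lemma edgeE:
  assumes "simple_graph G" "e \<in> edges G"
  obtains u v where "e = {u, v}" "u \<in> verts G" "v \<in> verts G" "u \<noteq> v" "adj G u v"
proof -
  obtain u v where "u \<in> verts G" "v \<in> verts G" "u \<noteq> v" "e = {u, v}"
    using assms unfolding simple_graph_def by blast
  then show thesis
    using that assms(2) by (simp add: adj_def)
qed

lemma reachable_refl: "v \<in> verts G \<Longrightarrow> reachable G v v"
  by (simp add: reachable_def)

lemma reachable_trans: "reachable G u v \<Longrightarrow> reachable G v w \<Longrightarrow> reachable G u w"
  by (auto simp: reachable_def)

lemma reachable_sym: "reachable G u v \<Longrightarrow> reachable G v u"
  using sympD[OF symp_rtranclp[OF sympI]] adj_sym unfolding reachable_def by metis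

lemma reachable_adj: "simple_graph G \<Longrightarrow> adj G u v \<Longrightarrow> reachable G u v"
  by (auto simp: reachable_def elim: adjE)

section \<open>Vertex deletion and tails of rays\<close>

lemma simple_graph_delete_verts: "simple_graph G \<Longrightarrow> simple_graph (delete_verts G F)"
  unfolding simple_graph_def delete_verts_def by fastforce

lemma adj_delete_verts: "adj (delete_verts G F) u v \<longleftrightarrow> adj G u v \<and> u \<notin> F \<and> v \<notin> F"
  by (auto simp: adj_def delete_verts_def)

lemma verts_delete_verts [simp]: "verts (delete_verts G F) = verts G - F"
  by (simp add: delete_verts_def)

lemma reachable_delete_verts_mono:
  assumes "reachable (delete_verts G F) u v" "F' \<subseteq> F"
  shows "reachable (delete_verts G F') u v"
proof -
  have "adj (delete_verts G F) \<le> adj (delete_verts G F')"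
    using assms(2) by (auto simp: adj_delete_verts)
  then show ?thesis
    using assms rtranclp_mono[of "adj (delete_verts G F)"] unfolding reachable_def
    by (auto dest: predicate2D)
qed

lemma ray_in_verts: "simple_graph G \<Longrightarrow> ray G r \<Longrightarrow> r n \<in> verts G"
  unfolding ray_def by (meson adjE)

text \<open>No edge of the ray from index \<open>n\<close> on touches \<open>F\<close>, so all of
  them survive the deletion. The single vertex \<open>r n\<close> can therefore stand for the whole
  tail.\<close>

lemma ray_tail_reachable:
  assumes G: "simple_graph G" and r: "ray G r"
    and avoid: "\<forall>m\<ge>n. r m \<notin> F" and "n \<le> m"
  shows "reachable (delete_verts G F) (r n) (r m)"
  using \<open>n \<le> m\<close>
proof (induction m rule: dec_induct)
  case base
  then show ?case
    using avoid ray_in_verts[OF G r] by (simp add: reachable_refl)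
next
  case (step m)
  have "adj (delete_verts G F) (r m) (r (Suc m))"
    using r avoid step.hyps by (simp add: ray_def adj_delete_verts)
  then show ?case
    using step.IH reachable_adj[OF simple_graph_delete_verts[OF G]] reachable_trans by metis
qed

text \<open>Injectivity of the ray makes the preimage of a finite set of vertices finite, hence
  bounded in \<open>nat\<close>.\<close>

lemma ray_eventually_avoids:
  assumes "ray G r" "finite F"
  obtains n where "\<forall>m\<ge>n. r m \<notin> F"
proof -
  have "finite (r -` F)"
    using assms by (simp add: ray_def finite_vimageI)
  then obtain k where "\<forall>m \<in> r -` F. m < k"
    using finite_nat_set_iff_bounded by blast
  then show thesis
    using that[of k] by (metis leD vimageI2)
qed

text \<open>The component containing the tail from index \<open>n\<close> consists of the vertices
  reachable from \<open>r n\<close>, so only \<open>F\<close> and \<open>n\<close> remain as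
  witnesses. Separation becomes a statement about one vertex, which combines directly with
  transitivity of reachability.\<close>

lemma dispersed_iff:
  assumes G: "simple_graph G"
  shows "dispersed G U \<longleftrightarrow> U \<subseteq> verts G \<and>
    (\<forall>r. ray G r \<longrightarrow> (\<exists>F n. finite F \<and> F \<subseteq> verts G \<and> (\<forall>m\<ge>n. r m \<notin> F) \<and>
      (\<forall>u \<in> U. \<not> reachable (delete_verts G F) (r n) u)))"
    (is "_ \<longleftrightarrow> _ \<and> (\<forall>r. ray G r \<longrightarrow> ?sep r)")
proof -
  have sep: "(\<exists>F K. finite F \<and> F \<subseteq> verts G \<and> K \<in> components (delete_verts G F) \<and>
      (\<exists>n. \<forall>m \<ge> n. r m \<in> K) \<and> K \<inter> U = {}) \<longleftrightarrow> ?sep r" (is "?lhs \<longleftrightarrow> _") if r: "ray G r" for r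
  proof
    assume ?lhs
    then obtain F v n where F: "finite F" "F \<subseteq> verts G"
      and tail: "\<forall>m\<ge>n. reachable (delete_verts G F) v (r m)"
      and disj: "{w. reachable (delete_verts G F) v w} \<inter> U = {}"
      unfolding components_def by blast
    have "\<forall>m\<ge>n. r m \<notin> F"
      using tail by (simp add: reachable_def)
    moreover have "\<forall>u \<in> U. \<not> reachable (delete_verts G F) (r n) u"
      using reachable_trans[OF tail[rule_format, OF order_refl]] disj by blast
    ultimately show "?sep r"
      using F by blast
  next
    assume "?sep r"
    then obtain F n where F: "finite F" "F \<subseteq> verts G" and avoid: "\<forall>m\<ge>n. r m \<notin> F"
      and unreach: "\<forall>u \<in> U. \<not> reachable (delete_verts G F) (r n) u"
      by blast
    let ?K = "{w. reachable (delete_verts G F) (r n) w}"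
    have "?K \<in> components (delete_verts G F)"
      using avoid ray_in_verts[OF G r] by (auto simp: components_def)
    moreover have "\<forall>m\<ge>n. r m \<in> ?K"
      using ray_tail_reachable[OF G r avoid] by simp
    ultimately show ?lhs
      using F unreach by blast
  qed
  show ?thesis
    unfolding dispersed_def by (intro conj_cong refl all_cong1 imp_cong sep)
qed

lemma dispersed_finite:
  assumes G: "simple_graph G" and "finite U" "U \<subseteq> verts G"
  shows "dispersed G U"
  unfolding dispersed_iff[OF G]
proof (intro conjI allI impI)
  fix r
  assume "ray G r"
  then obtain n where "\<forall>m\<ge>n. r m \<notin> U"
    using ray_eventually_avoids \<open>finite U\<close> by blast
  \<comment> \<open>\<open>U\<close> is its own separator: \<open>reachable\<close> requires its end
    vertex to survive the deletion.\<close>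
  moreover have "\<forall>u \<in> U. \<not> reachable (delete_verts G U) (r n) u"
    by (simp add: reachable_def)
  ultimately show "\<exists>F n. finite F \<and> F \<subseteq> verts G \<and> (\<forall>m\<ge>n. r m \<notin> F) \<and>
      (\<forall>u \<in> U. \<not> reachable (delete_verts G F) (r n) u)"
    using assms by (intro exI[of _ U] exI[of _ n]) simp
qed (fact assms)

text \<open>The union of the two separators works from index \<open>max n n'\<close> on. A path
  avoiding both separators also avoids each of them, and the ray segment from \<open>n\<close> or
  \<open>n'\<close> can be put in front of it, which contradicts one of the two given
  separations.\<close>

lemma dispersed_Un:
  assumes G: "simple_graph G" and U: "dispersed G U" and V: "dispersed G V"
  shows "dispersed G (U \<union> V)"
  unfolding dispersed_iff[OF G]
proof (intro conjI allI impI)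
  show "U \<union> V \<subseteq> verts G"
    using U V by (simp add: dispersed_def)
next
  fix r
  assume r: "ray G r"
  obtain F n where F: "finite F" "F \<subseteq> verts G" "\<forall>m\<ge>n. r m \<notin> F"
    and sepU: "\<forall>u \<in> U. \<not> reachable (delete_verts G F) (r n) u"
    using U r unfolding dispersed_iff[OF G] by blast
  obtain F' n' where F': "finite F'" "F' \<subseteq> verts G" "\<forall>m\<ge>n'. r m \<notin> F'"
    and sepV: "\<forall>u \<in> V. \<not> reachable (delete_verts G F') (r n') u"
    using V r unfolding dispersed_iff[OF G] by blast
  let ?k = "max n n'"
  have "\<not> reachable (delete_verts G (F \<union> F')) (r ?k) u" if "u \<in> U \<union> V" for u
  proof
    assume u: "reachable (delete_verts G (F \<union> F')) (r ?k) u"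
    have "reachable (delete_verts G F) (r n) u"
      using ray_tail_reachable[OF G r F(3), of ?k] reachable_delete_verts_mono[OF u, of F]
        reachable_trans by fastforce
    moreover have "reachable (delete_verts G F') (r n') u"
      using ray_tail_reachable[OF G r F'(3), of ?k] reachable_delete_verts_mono[OF u, of F']
        reachable_trans by fastforce
    ultimately show False
      using that sepU sepV by blast
  qed
  then show "\<exists>F n. finite F \<and> F \<subseteq> verts G \<and> (\<forall>m\<ge>n. r m \<notin> F) \<and>
      (\<forall>u \<in> U \<union> V. \<not> reachable (delete_verts G F) (r n) u)"
    using F F' by (intro exI[of _ "F \<union> F'"] exI[of _ ?k]) auto
qed

text \<open>Induction from the empty set, which is dispersed because it is finite. This makes the
  preimage of a finite separator dispersed as soon as all fibres over it are.\<close>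

lemma dispersed_finite_UN:
  assumes G: "simple_graph G" and "finite I" "\<And>i. i \<in> I \<Longrightarrow> dispersed G (U i)"
  shows "dispersed G (\<Union>i\<in>I. U i)"
  using assms(2,3) by (induction I) (auto intro: dispersed_finite[OF G] dispersed_Un[OF G])

text \<open>Any visit to \<open>U\<close> at an index \<open>m \<ge> n\<close> would be reachable
  from \<open>r n\<close> along the ray itself. The set \<open>U\<close> may be infinite.\<close>

lemma ray_finitely_often_in_dispersed:
  assumes G: "simple_graph G" and U: "dispersed G U" and r: "ray G r"
  shows "finite {m. r m \<in> U}"
proof -
  obtain F n where F: "\<forall>m\<ge>n. r m \<notin> F"
    and sep: "\<forall>u \<in> U. \<not> reachable (delete_verts G F) (r n) u"
    using U r unfolding dispersed_iff[OF G] by blast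
  have "{m. r m \<in> U} \<subseteq> {..<n}"
    using sep ray_tail_reachable[OF G r F] by (force simp: not_less[symmetric])
  then show ?thesis
    using finite_subset by blast
qed

section \<open>Strongly proper morphisms\<close>

text \<open>The walk may pause and revisit vertices, as the image of a ray under a 1-complex
  morphism does. The bound \<open>k \<le> t k\<close> ensures that late vertices of the extracted
  ray come from late times of the walk.\<close>

lemma ray_in_walk:
  assumes walk: "\<And>n. adj G (w n) (w (Suc n)) \<or> w n = w (Suc n)"
    and fin: "\<And>n. finite {m. w m = w n}"
  obtains t :: "nat \<Rightarrow> nat" where "ray G (w \<circ> t)" "\<And>k. k \<le> t k"
proof -
  define last where "last n = Max {m. w m = w n}" for n
  have w_last: "w (last n) = w n" for n
    using Max_in[OF fin[of n]] unfolding last_def by blast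
  have le_last: "m \<le> last n" if "w m = w n" for m n
    using Max_ge[OF fin[of n]] that unfolding last_def by blast
  \<comment> \<open>From the last visit of a vertex, one step of the walk reaches another vertex;
    \<open>t\<close> then jumps to the last visit of that one.\<close>
  define t where "t = rec_nat (last 0) (\<lambda>_ i. last (Suc i))"
  have t_Suc: "t (Suc k) = last (Suc (t k))" for k
    by (simp add: t_def)
  \<comment> \<open>Every \<open>t k\<close> is a value of \<open>last\<close>, so its vertex never
    recurs later. This yields both injectivity and the absence of a pause right after
    \<open>t k\<close>.\<close>
  have t_max: "m \<le> t k" if "w m = w (t k)" for m k
  proof -
    obtain i where "t k = last i"
      by (cases k) (auto simp: t_def)
    then show ?thesis
      using that le_last w_last by metis
  qed
  have t_less: "t k < t (Suc k)" for k
    using le_last[of "Suc (t k)"] by (simp add: t_Suc Suc_le_eq)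
  have mono: "strict_mono t"
    using t_less by (simp add: strict_mono_Suc_iff)
  have "inj (w \<circ> t)"
    using t_max strict_mono_eq[OF mono] by (metis (mono_tags, lifting) comp_apply injI order_antisym)
  \<comment> \<open>A pause at \<open>t k\<close> would be a later visit of the same vertex, so the
    walk moves along an edge; \<open>w_last\<close> identifies its far end with the vertex at
    \<open>t (Suc k)\<close>.\<close>
  moreover have "adj G (w (t k)) (w (t (Suc k)))" for k
    using walk[of "t k"] t_max[of "Suc (t k)" k] w_last[of "Suc (t k)"] by (auto simp: t_Suc)
  ultimately have "ray G (w \<circ> t)"
    by (simp add: ray_def)
  then show thesis
    using that strict_mono_imp_increasing[OF mono] by blast
qed

text \<open>The image of a path is a walk with pauses, and it survives the deletion of
  \<open>F2\<close> because no vertex on it lies there. Assuming this for everything reachable from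
  \<open>x\<close> avoids naming a path.\<close>

lemma complex_morphism_reachable:
  assumes \<psi>: "complex_morphism H1 H2 \<psi>" and H2: "simple_graph H2"
    and xy: "reachable (delete_verts H1 F1) x y"
    and avoid: "\<And>z. reachable (delete_verts H1 F1) x z \<Longrightarrow> \<psi> z \<notin> F2"
    and H1: "simple_graph H1"
  shows "reachable (delete_verts H2 F2) (\<psi> x) (\<psi> y)"
proof -
  have "(adj (delete_verts H1 F1))\<^sup>*\<^sup>* x y" and x: "x \<in> verts (delete_verts H1 F1)"
    using xy by (auto simp: reachable_def)
  \<comment> \<open>The first conjunct travels along so that \<open>avoid\<close> applies to every
    vertex met.\<close>
  then have "reachable (delete_verts H1 F1) x y \<and> reachable (delete_verts H2 F2) (\<psi> x) (\<psi> y)"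
  proof (induction rule: rtranclp_induct)
    case base
    have "\<psi> x \<in> verts H2"
      using \<psi> x by (auto simp: complex_morphism_def)
    then show ?case
      using x avoid reachable_refl[OF x] by (auto intro: reachable_refl)
  next
    case (step y z)
    have z: "reachable (delete_verts H1 F1) x z"
      using step reachable_adj[OF simple_graph_delete_verts[OF H1]] reachable_trans by metis
    have "adj H1 y z"
      using step.hyps by (simp add: adj_delete_verts)
    then consider "\<psi> y = \<psi> z" | "adj H2 (\<psi> y) (\<psi> z)"
      using \<psi> by (auto simp: complex_morphism_def)
    then have "reachable (delete_verts H2 F2) (\<psi> x) (\<psi> z)"
    proof cases
      case 2
      then have "adj (delete_verts H2 F2) (\<psi> y) (\<psi> z)"
        using avoid z step by (simp add: adj_delete_verts)
      then show ?thesis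
        using step reachable_adj[OF simple_graph_delete_verts[OF H2]] reachable_trans by metis
    qed (use step in simp)
    then show ?case
      using z by simp
  qed
  then show ?thesis ..
qed

text \<open>Needed for composition: a fibre of a composite is the preimage of a fibre of the second
  map, which is dispersed but possibly infinite.\<close>

lemma strongly_proper_dispersed_preimage:
  assumes H1: "simple_graph H1" and H2: "simple_graph H2"
    and \<psi>: "strongly_proper H1 H2 \<psi>" and W: "dispersed H2 W"
  shows "dispersed H1 {u \<in> verts H1. \<psi> u \<in> W}"
  unfolding dispersed_iff[OF H1]
proof (intro conjI allI impI)
  fix r
  assume r: "ray H1 r"
  have cm: "complex_morphism H1 H2 \<psi>"
    and fibre: "\<And>v. v \<in> verts H2 \<Longrightarrow> dispersed H1 {u \<in> verts H1. \<psi> u = v}"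
    using \<psi> by (auto simp: strongly_proper_def)
  have "\<psi> (r n) \<in> verts H2" for n
    using cm ray_in_verts[OF H1 r] by (auto simp: complex_morphism_def)
  \<comment> \<open>The ray \<open>r\<close> meets each dispersed fibre only finitely often, so the
    image walk satisfies the finiteness condition of \<open>ray_in_walk\<close>.\<close>
  then have "finite {m. \<psi> (r m) = \<psi> (r n)}" for n
    using ray_finitely_often_in_dispersed[OF H1 fibre r] ray_in_verts[OF H1 r] by simp
  moreover have "adj H2 (\<psi> (r n)) (\<psi> (r (Suc n))) \<or> \<psi> (r n) = \<psi> (r (Suc n))" for n
    using cm r by (auto simp: complex_morphism_def ray_def)
  ultimately obtain t where s: "ray H2 ((\<lambda>n. \<psi> (r n)) \<circ> t)" and t: "\<And>k. k \<le> t k"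
    using ray_in_walk[of H2 "\<lambda>n. \<psi> (r n)"] by blast
  obtain F2 n2 where F2: "finite F2" "F2 \<subseteq> verts H2" "\<forall>m\<ge>n2. ((\<lambda>n. \<psi> (r n)) \<circ> t) m \<notin> F2"
    and sep2: "\<forall>u \<in> W. \<not> reachable (delete_verts H2 F2) (((\<lambda>n. \<psi> (r n)) \<circ> t) n2) u"
    using W s unfolding dispersed_iff[OF H2] by blast
  \<comment> \<open>The preimage of \<open>F2\<close> may be infinite and so cannot serve as a
    separator. As a finite union of fibres it is dispersed, and a finite \<open>F1\<close> cuts it
    off from \<open>r\<close>.\<close>
  have "{u \<in> verts H1. \<psi> u \<in> F2} = (\<Union>v\<in>F2. {u \<in> verts H1. \<psi> u = v})"
    by blast
  then have "dispersed H1 {u \<in> verts H1. \<psi> u \<in> F2}"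
    using dispersed_finite_UN[OF H1 F2(1)] fibre F2(2) by (metis (no_types, lifting) subsetD)
  then obtain F1 n1 where F1: "finite F1" "F1 \<subseteq> verts H1" "\<forall>m\<ge>n1. r m \<notin> F1"
    and sep1: "\<forall>u \<in> {u \<in> verts H1. \<psi> u \<in> F2}. \<not> reachable (delete_verts H1 F1) (r n1) u"
    using r unfolding dispersed_iff[OF H1] by blast
  have "\<not> reachable (delete_verts H1 F1) (r n1) u" if u: "\<psi> u \<in> W" for u
  proof
    assume "reachable (delete_verts H1 F1) (r n1) u"
    \<comment> \<open>Since \<open>t ?k \<ge> ?k\<close>, the vertex \<open>r (t ?k)\<close> lies in
      the tail of \<open>r\<close> from \<open>n1\<close>, while its image lies in the tail of the
      image ray from \<open>n2\<close>.\<close>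
    let ?k = "max n1 n2"
    have n1: "reachable (delete_verts H1 F1) (r n1) (r (t ?k))"
      using ray_tail_reachable[OF H1 r F1(3)] t[of ?k] by simp
    have "\<psi> z \<notin> F2" if "reachable (delete_verts H1 F1) (r (t ?k)) z" for z
    proof -
      have "z \<in> verts H1"
        using that by (simp add: reachable_def)
      then show ?thesis
        using sep1 reachable_trans[OF n1 that] by blast
    qed
    \<comment> \<open>The connection from \<open>r (t ?k)\<close> through \<open>r n1\<close> to
      \<open>u\<close> stays in a component that misses the preimage of \<open>F2\<close>, so it can
      be pushed forward.\<close>
    then have "reachable (delete_verts H2 F2) (\<psi> (r (t ?k))) (\<psi> u)"
      using complex_morphism_reachable[OF cm H2 _ _ H1] n1 reachable_sym reachable_trans
        \<open>reachable (delete_verts H1 F1) (r n1) u\<close> by metis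
    moreover have "reachable (delete_verts H2 F2) (\<psi> (r (t n2))) (\<psi> (r (t ?k)))"
      using ray_tail_reachable[OF H2 s F2(3), of ?k] by simp
    ultimately show False
      using sep2 u reachable_trans by fastforce
  qed
  then show "\<exists>F n. finite F \<and> F \<subseteq> verts H1 \<and> (\<forall>m\<ge>n. r m \<notin> F) \<and>
      (\<forall>u \<in> {u \<in> verts H1. \<psi> u \<in> W}. \<not> reachable (delete_verts H1 F) (r n) u)"
    using F1 by blast
qed blast

section \<open>Identities and composites of strongly proper morphisms\<close>

lemma strongly_proper_id:
  assumes "simple_graph H"
  shows "strongly_proper H H (restrict id (verts H))"
  unfolding strongly_proper_def complex_morphism_def
  using assms by (auto elim: adjE intro!: dispersed_finite intro: finite_subset[of _ "{_}"])

lemma complex_morphism_compose: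
  assumes "simple_graph H1" "complex_morphism H1 H2 f" "complex_morphism H2 H3 g"
  shows "complex_morphism H1 H3 (compose (verts H1) g f)"
proof -
  have "compose (verts H1) g f \<in> verts H1 \<rightarrow>\<^sub>E verts H3"
    using assms by (auto simp: complex_morphism_def compose_def)
  \<comment> \<open>Simplicity puts \<open>u\<close> and \<open>v\<close> into
    \<open>verts H1\<close>, where \<open>compose\<close> is ordinary composition. An edge collapsed
    by \<open>f\<close> stays collapsed under \<open>g\<close>.\<close>
  moreover have "adj H3 (compose (verts H1) g f u) (compose (verts H1) g f v) \<or>
      compose (verts H1) g f u = compose (verts H1) g f v" if "adj H1 u v" for u v
    using assms that by (auto simp: complex_morphism_def compose_def elim!: adjE) metis+
  ultimately show ?thesis
    by (simp add: complex_morphism_def)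
qed

lemma strongly_proper_compose:
  assumes H: "simple_graph H1" "simple_graph H2"
    and f: "strongly_proper H1 H2 f" and g: "strongly_proper H2 H3 g"
  shows "strongly_proper H1 H3 (compose (verts H1) g f)"
proof -
  have "dispersed H1 {u \<in> verts H1. compose (verts H1) g f u = v}" if "v \<in> verts H3" for v
  proof -
    have "f \<in> verts H1 \<rightarrow> verts H2"
      using f by (auto simp: strongly_proper_def complex_morphism_def)
    then have "{u \<in> verts H1. compose (verts H1) g f u = v} =
        {u \<in> verts H1. f u \<in> {w \<in> verts H2. g w = v}}"
      by (auto simp: compose_def)
    moreover have "dispersed H2 {w \<in> verts H2. g w = v}"
      using g that by (simp add: strongly_proper_def)
    ultimately show ?thesis
      by (simp only: strongly_proper_dispersed_preimage[OF H f])
  qed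
  then show ?thesis
    using f g complex_morphism_compose[OF H(1)] by (auto simp: strongly_proper_def)
qed

text \<open>Shared by both categories. Outside \<open>V X\<close> both sides of each law are
  \<open>undefined\<close>; inside, the left unit law and associativity need the first map to land
  where the outer map is not \<open>undefined\<close>.\<close>

lemma category_extensional_maps:
  assumes maps: "\<And>X Y f. R X Y f \<Longrightarrow> f \<in> V X \<rightarrow>\<^sub>E V Y"
    and id: "\<And>X. X \<in> Ob \<Longrightarrow> R X X (restrict id (V X))"
    and comp: "\<And>X Y Z f g. \<lbrakk>X \<in> Ob; Y \<in> Ob; R X Y f; R Y Z g\<rbrakk> \<Longrightarrow> R X Z (compose (V X) g f)"
  shows "category \<lparr>Obj = Ob, Hom = \<lambda>X Y. {f. R X Y f}, Id = \<lambda>X. restrict id (V X),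
    Comp = \<lambda>X Y Z g f. compose (V X) g f\<rparr>"
proof -
  have ext: "f x = undefined" if "R X Y f" "x \<notin> V X" for X Y f x
    using maps[OF that(1)] that(2) by (rule PiE_arb)
  have mem: "f x \<in> V Y" if "R X Y f" "x \<in> V X" for X Y f x
    using maps[OF that(1)] that(2) by (rule PiE_mem)
  show ?thesis
  proof (unfold_locales, goal_cases)
    case (1 X)
    then show ?case
      using id by simp
  next
    case (2 X Y Z f g)
    then show ?case
      using comp[of X Y f Z g] by simp
  next
    case (3 X Y f)
    then show ?case
      using ext[of X Y f] by (auto simp: compose_def fun_eq_iff)
  next
    case (4 X Y f)
    then show ?case
      using ext[of X Y f] mem[of X Y f] by (auto simp: compose_def fun_eq_iff)
  next
    case (5 W X Y Z f g h)
    then show ?case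
      using mem[of W X f] by (auto simp: compose_def fun_eq_iff)
  qed
qed

lemma category_Graph_SP: "category (Graph_SP :: ('a graph, 'a \<Rightarrow> 'a) category_data)"
  unfolding Graph_SP_def
proof (rule category_extensional_maps)
  show "strongly_proper X Y f \<Longrightarrow> f \<in> verts X \<rightarrow>\<^sub>E verts Y" for X Y :: "'a graph" and f
    by (simp add: strongly_proper_def complex_morphism_def)
qed (auto simp: connected_graph_def intro: strongly_proper_id strongly_proper_compose)

section \<open>Strongly line-proper morphisms\<close>

lemma graph_hom_image_edge:
  assumes "simple_graph G1" "graph_hom G1 G2 \<phi>" "e \<in> edges G1"
  shows "\<phi> ` e \<in> edges G2"
  using assms by (auto simp: graph_hom_def adj_def elim!: edgeE)

text \<open>Every edge is a pair, so the set in \<open>strongly_line_proper\<close> is a fibre of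
  the map taking edges to their images, the map underlying the line graph functor.\<close>

lemma edge_fibre_eq:
  assumes "simple_graph G1"
  shows "{{u, v} | u v. {u, v} \<in> edges G1 \<and> {\<phi> u, \<phi> v} = e} = {d \<in> edges G1. \<phi> ` d = e}"
proof (intro equalityI subsetI)
  fix d
  assume "d \<in> {d \<in> edges G1. \<phi> ` d = e}"
  moreover from this obtain u v where "d = {u, v}"
    using edgeE[OF assms] by blast
  ultimately show "d \<in> {{u, v} | u v. {u, v} \<in> edges G1 \<and> {\<phi> u, \<phi> v} = e}"
    by auto
qed auto

lemma strongly_line_proper_iff:
  assumes "simple_graph G1"
  shows "strongly_line_proper G1 G2 \<phi> \<longleftrightarrow>
    graph_hom G1 G2 \<phi> \<and> (\<forall>e \<in> edges G2. finite {d \<in> edges G1. \<phi> ` d = e})"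
  unfolding strongly_line_proper_def edge_fibre_eq[OF assms] ..

lemma edge_subset_verts: "simple_graph G \<Longrightarrow> e \<in> edges G \<Longrightarrow> e \<subseteq> verts G"
  by (erule edgeE) auto

lemma compose_image: "e \<subseteq> A \<Longrightarrow> compose A g f ` e = g ` f ` e"
  by (auto simp: compose_def image_iff subset_iff)

lemma strongly_line_proper_id:
  assumes G: "simple_graph G"
  shows "strongly_line_proper G G (restrict id (verts G))"
proof -
  have "restrict id (verts G) ` d = d" if "d \<in> edges G" for d
    using edge_subset_verts[OF G that] by force
  then have "{d \<in> edges G. restrict id (verts G) ` d = e} \<subseteq> {e}" for e
    by auto
  then have "finite {d \<in> edges G. restrict id (verts G) ` d = e}" for e
    using finite_subset by blast
  moreover have "graph_hom G G (restrict id (verts G))"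
    using G by (auto simp: graph_hom_def elim: adjE)
  ultimately show ?thesis
    using strongly_line_proper_iff[OF G] by blast
qed

text \<open>The edge fibre of the composite over \<open>e\<close> is covered by the fibres of
  \<open>f\<close> over those edges \<open>c\<close> that \<open>g\<close> sends to
  \<open>e\<close>: a finite union of finite sets.\<close>

lemma strongly_line_proper_compose:
  assumes G: "simple_graph G1" "simple_graph G2"
    and f: "strongly_line_proper G1 G2 f" and g: "strongly_line_proper G2 G3 g"
  shows "strongly_line_proper G1 G3 (compose (verts G1) g f)"
proof -
  have homs: "graph_hom G1 G2 f" "graph_hom G2 G3 g"
    using f g by (auto simp: strongly_line_proper_def)
  have "finite {d \<in> edges G1. compose (verts G1) g f ` d = e}" if "e \<in> edges G3" for e
  proof -
    have "{d \<in> edges G1. compose (verts G1) g f ` d = e} \<subseteq>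
        (\<Union>c \<in> {c \<in> edges G2. g ` c = e}. {d \<in> edges G1. f ` d = c})"
      using graph_hom_image_edge[OF G(1) homs(1)]
        compose_image[OF edge_subset_verts[OF G(1)], of _ g f]
      by (simp add: subset_iff cong: conj_cong)
    moreover have "finite \<dots>"
      using f g that by (auto simp: strongly_line_proper_iff G)
    ultimately show ?thesis
      by (rule finite_subset)
  qed
  moreover have "graph_hom G1 G3 (compose (verts G1) g f)"
    using homs G by (auto simp: graph_hom_def compose_def elim: adjE)
  ultimately show ?thesis
    by (simp add: strongly_line_proper_iff G)
qed

lemma category_Graph_LP: "category (Graph_LP :: ('a graph, 'a \<Rightarrow> 'a) category_data)"
  unfolding Graph_LP_def
proof (rule category_extensional_maps)
  show "strongly_line_proper X Y f \<Longrightarrow> f \<in> verts X \<rightarrow>\<^sub>E verts Y" for X Y :: "'a graph" and f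
    by (simp add: strongly_line_proper_def graph_hom_def)
qed (auto simp: connected_graph_def intro: strongly_line_proper_id strongly_line_proper_compose)

section \<open>The line graph functor\<close>

lemma verts_line_graph [simp]: "verts (line_graph G) = edges G"
  by (simp add: line_graph_def)

lemma adj_line_graph:
  "adj (line_graph G) e f \<longleftrightarrow> e \<in> edges G \<and> f \<in> edges G \<and> e \<noteq> f \<and> e \<inter> f \<noteq> {}"
  by (auto simp: adj_def line_graph_def doubleton_eq_iff)

lemma simple_graph_line_graph: "simple_graph (line_graph G)"
  by (auto simp: simple_graph_def line_graph_def)

text \<open>Adjacency in the line graph excludes \<open>e = f\<close>; that case is reflexivity.
  Reachability treats both cases alike.\<close>

lemma reachable_line_graph_meeting:
  assumes "e \<in> edges G" "f \<in> edges G" "e \<inter> f \<noteq> {}"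
  shows "reachable (line_graph G) e f"
  using assms reachable_adj[OF simple_graph_line_graph] adj_line_graph reachable_refl
  by (metis verts_line_graph)

text \<open>A walk in \<open>G\<close> from an end of \<open>e\<close> to an end of \<open>f\<close>
  traverses edges that successively share a vertex.\<close>

lemma connected_line_graph:
  assumes "connected_graph G"
  shows "connected_graph (line_graph G)"
proof -
  have G: "simple_graph G"
    using assms by (simp add: connected_graph_def)
  have "reachable (line_graph G) e f" if e: "e \<in> edges G" and f: "f \<in> edges G" for e f
  proof -
    obtain u x where u: "u \<in> e" and x: "x \<in> f"
      using G e f by (metis edgeE insertI1)
    have "u \<in> verts G" "x \<in> verts G"
      using edge_subset_verts[OF G e] edge_subset_verts[OF G f] u x by auto
    then have "reachable G u x"
      using assms by (simp add: connected_graph_def)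
    then have "(adj G)\<^sup>*\<^sup>* u x"
      by (simp add: reachable_def)
    \<comment> \<open>The claim covers all edges at the current vertex, so the induction hypothesis
      applies to the edge traversed next.\<close>
    then have "\<forall>d \<in> edges G. x \<in> d \<longrightarrow> reachable (line_graph G) e d"
    proof (induction rule: rtranclp_induct)
      case base
      then show ?case
        using u e reachable_line_graph_meeting by blast
    next
      case (step y z)
      then have yz: "{y, z} \<in> edges G"
        by (simp add: adj_def)
      then have "reachable (line_graph G) e {y, z}"
        using step.IH by blast
      then show ?case
        using reachable_line_graph_meeting[OF yz] reachable_trans by fastforce
    qed
    then show ?thesis
      using f x by blast
  qed
  then show ?thesis
    by (simp add: connected_graph_def simple_graph_line_graph)
qed

text \<open>Edges sharing a vertex have images sharing its image. These may coincide, which is why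
  the target category has 1-complex morphisms rather than graph homomorphisms.\<close>

lemma strongly_proper_image:
  assumes G1: "simple_graph G1" and \<phi>: "strongly_line_proper G1 G2 \<phi>"
  shows "strongly_proper (line_graph G1) (line_graph G2) (restrict ((`) \<phi>) (edges G1))"
    (is "strongly_proper _ _ ?\<psi>")
proof -
  have hom: "graph_hom G1 G2 \<phi>"
    and fin: "\<And>e. e \<in> edges G2 \<Longrightarrow> finite {d \<in> edges G1. \<phi> ` d = e}"
    using \<phi> by (auto simp: strongly_line_proper_iff[OF G1])
  have "complex_morphism (line_graph G1) (line_graph G2) ?\<psi>"
    using graph_hom_image_edge[OF G1 hom] by (auto simp: complex_morphism_def adj_line_graph)
  moreover have "dispersed (line_graph G1) {d \<in> edges G1. ?\<psi> d = e}" if "e \<in> edges G2" for e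
  proof -
    have "{d \<in> edges G1. ?\<psi> d = e} = {d \<in> edges G1. \<phi> ` d = e}"
      by auto
    then show ?thesis
      using dispersed_finite[OF simple_graph_line_graph] fin[OF that] by fastforce
  qed
  ultimately show ?thesis
    by (simp add: strongly_proper_def)
qed

text \<open>The image map is restricted to \<open>edges G1\<close>, the vertex set of the line
  graph, because morphisms are extensional.\<close>

definition line_functor :: "('a graph, 'a \<Rightarrow> 'a, 'a set graph, 'a set \<Rightarrow> 'a set) functor_data" where
  "line_functor =
    \<lparr>on_obj = line_graph, on_hom = (\<lambda>G1 G2 \<phi>. restrict ((`) \<phi>) (edges G1))\<rparr>"

lemma category_functor_line_functor: "category_functor Graph_LP Graph_SP line_functor"
proof (intro category_functor.intro category_Graph_LP category_Graph_SP
    category_functor_axioms.intro)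
  fix X :: "'a graph"
  assume X: "X \<in> Obj Graph_LP"
  then show "on_obj line_functor X \<in> Obj Graph_SP"
    by (simp add: line_functor_def Graph_LP_def Graph_SP_def connected_line_graph)
  have "restrict id (verts X) ` e = e" if "e \<in> edges X" for e
    using X edge_subset_verts[OF _ that] by (force simp: Graph_LP_def connected_graph_def)
  then show "on_hom line_functor X X (Id Graph_LP X) = Id Graph_SP (on_obj line_functor X)"
    by (simp add: line_functor_def Graph_LP_def Graph_SP_def cong: restrict_cong)
next
  fix X Y :: "'a graph" and f
  assume "X \<in> Obj Graph_LP" "f \<in> Hom Graph_LP X Y"
  then show "on_hom line_functor X Y f \<in>
      Hom Graph_SP (on_obj line_functor X) (on_obj line_functor Y)"
    by (simp add: line_functor_def Graph_LP_def Graph_SP_def connected_graph_def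
        strongly_proper_image)
next
  fix X Y Z :: "'a graph" and f g
  assume X: "X \<in> Obj Graph_LP" and f: "f \<in> Hom Graph_LP X Y"
  have sX: "simple_graph X"
    using X by (simp add: Graph_LP_def connected_graph_def)
  \<comment> \<open>The outer map is restricted to \<open>edges Y\<close>, so it agrees with taking
    images only on edges of \<open>Y\<close>.\<close>
  have "f ` e \<in> edges Y" if "e \<in> edges X" for e
    using f graph_hom_image_edge[OF sX, of Y f e] that
    by (simp add: Graph_LP_def strongly_line_proper_def)
  then show "on_hom line_functor X Z (Comp Graph_LP X Y Z g f) =
      Comp Graph_SP (on_obj line_functor X) (on_obj line_functor Y) (on_obj line_functor Z)
        (on_hom line_functor Y Z g) (on_hom line_functor X Y f)"
    by (simp add: line_functor_def Graph_LP_def Graph_SP_def fun_eq_iff compose_image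
        edge_subset_verts[OF sX] restrict_def compose_def[of "edges X"])
qed

theorem theorem21:
  "category (Graph_LP :: ('a graph, 'a \<Rightarrow> 'a) category_data) \<and>
   (\<exists>L :: ('a graph, 'a \<Rightarrow> 'a, 'a set graph, 'a set \<Rightarrow> 'a set) functor_data.
      category_functor Graph_LP Graph_SP L \<and>
      (\<forall>G. connected_graph G \<longrightarrow> on_obj L G = line_graph G) \<and>
      (\<forall>G1 G2 \<phi>.
         connected_graph G1 \<and> connected_graph G2 \<and> strongly_line_proper G1 G2 \<phi> \<longrightarrow>
         strongly_proper (line_graph G1) (line_graph G2) (on_hom L G1 G2 \<phi>) \<and>
         (\<forall>u v. {u, v} \<in> edges G1 \<longrightarrow> on_hom L G1 G2 \<phi> {u, v} = {\<phi> u, \<phi> v})))"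
proof (intro conjI exI[of _ line_functor] allI impI category_Graph_LP
    category_functor_line_functor)
  fix G1 G2 :: "'a graph" and \<phi>
  assume *: "connected_graph G1 \<and> connected_graph G2 \<and> strongly_line_proper G1 G2 \<phi>"
  then show "strongly_proper (line_graph G1) (line_graph G2) (on_hom line_functor G1 G2 \<phi>)"
    by (simp add: line_functor_def connected_graph_def strongly_proper_image)
qed (simp_all add: line_functor_def)

end
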